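(* There is a one-sided, non-adaptive algorithm which, given an accuracy parameter $\varepsilon>0$ and access to the oracles $\mathrm{Samp}(f)$ and $\mathrm{MQ}(f)$ of an unknown $f:\{0,1\}^n\to\{0,1\}$, is an $\varepsilon$-relative-error tester for the class of conjunctions over $\{0,1\}^n$, and which makes $O(1/\varepsilon)$ calls in total to $\mathrm{Samp}(f)$ and $\mathrm{MQ}(f)$.
   Context: A conjunction is a function $\ell_1\wedge\cdots\wedge\ell_k$ where each literal $\ell_i$ is a variable $x_j$ or its negation $\overline{x_j}$. $\mathrm{MQ}(f)$ is the membership-query oracle: on input $x$ it returns $f(x)$. $\mathrm{Samp}(f)$ returns, on each call, an independent uniformly random element of $f^{-1}(1)$. For $f,g:\{0,1\}^n\to\{0,1\}$ with $f^{-1}(1)\neq\emptyset$, the relative distance is $\mathrm{rel}\text{-}\mathrm{dist}(f,g)=|f^{-1}(1)\triangle g^{-1}(1)|/|f^{-1}(1)|$, and $\mathrm{rel}\text{-}\mathrm{dist}(f,\mathcal{C})=\min_{g\in\mathcal{C}}\mathrm{rel}\text{-}\mathrm{dist}(f,g)$. An $\varepsilon$-relative-error tester for a class $\mathcal{C}$ must accept with probability at least $2/3$ if $f\in\mathcal{C}$ and reject with probability at least $2/3$ if $\mathrm{rel}\text{-}\mathrm{dist}(f,\mathcal{C})\ge\varepsilon$. It is one-sided if it accepts every $f\in\mathcal{C}$ with probability $1$. It is non-adaptive if its queries do not depend on answers to previous queries. *)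

theory Defs
  imports "HOL-Probability.Probability"
begin

section \<open>Boolean functions and relative distance\<close>

definition cube :: "nat \<Rightarrow> bool list set" where
  "cube n = {x. length x = n}"

text \<open>Functions on the cube are extensional, so that equality of functions
  (and hence membership in a class) only concerns their values on the cube.\<close>

definition bool_funs :: "nat \<Rightarrow> (bool list \<Rightarrow> bool) set" where
  "bool_funs n = cube n \<rightarrow>\<^sub>E UNIV"

definition ones :: "nat \<Rightarrow> (bool list \<Rightarrow> bool) \<Rightarrow> bool list set" where
  "ones n f = {x \<in> cube n. f x}"

definition rel_dist :: "nat \<Rightarrow> (bool list \<Rightarrow> bool) \<Rightarrow> (bool list \<Rightarrow> bool) \<Rightarrow> real" where
  "rel_dist n f g =
     real (card ((ones n f - ones n g) \<union> (ones n g - ones n f))) / real (card (ones n f))"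

definition rel_dist_class ::
    "nat \<Rightarrow> (bool list \<Rightarrow> bool) \<Rightarrow> (bool list \<Rightarrow> bool) set \<Rightarrow> real" where
  "rel_dist_class n f C = Min (rel_dist n f ` C)"

section \<open>Conjunctions\<close>

datatype literal = Pos (var: nat) | Neg (var: nat)

primrec lit_holds :: "literal \<Rightarrow> bool list \<Rightarrow> bool" where
  "lit_holds (Pos j) x = x ! j"
| "lit_holds (Neg j) x = (\<not> x ! j)"

text \<open>The empty list of literals gives the constant-one function, and a list may
  contain both a variable and its negation, which gives the constant-zero function.\<close>

definition conjunctions :: "nat \<Rightarrow> (bool list \<Rightarrow> bool) set" where
  "conjunctions n =
     {restrict (\<lambda>x. \<forall>l\<in>set ls. lit_holds l x) (cube n) | ls. \<forall>l\<in>set ls. var l < n}"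

section \<open>Algorithms with oracle access\<close>

text \<open>A deterministic strategy is a well-founded decision tree whose inner nodes are
  oracle calls and whose leaves are verdicts (\<open>True\<close> means accept). A randomized
  algorithm is a distribution over such trees: all internal coins are tossed
  at the outset, while the randomness of the sampling oracle is resolved in \<open>run\<close>.
  Only oracle calls are charged for; there is no computational restriction.\<close>

datatype strategy =
    Output bool
  | Samp "bool list \<Rightarrow> strategy"
  | MQ "bool list" "bool \<Rightarrow> strategy"

type_synonym algorithm = "strategy pmf"

text \<open>The result is meaningful only if \<open>ones n f\<close> is nonempty, since the sampling
  oracle is undefined otherwise.\<close>

primrec run :: "nat \<Rightarrow> (bool list \<Rightarrow> bool) \<Rightarrow> strategy \<Rightarrow> bool pmf" where
  "run n f (Output b) = return_pmf b"
| "run n f (Samp k) = bind_pmf (pmf_of_set (ones n f)) (\<lambda>x. run n f (k x))"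
| "run n f (MQ x k) = run n f (k (f x))"

definition verdict :: "nat \<Rightarrow> (bool list \<Rightarrow> bool) \<Rightarrow> algorithm \<Rightarrow> bool pmf" where
  "verdict n f A = bind_pmf A (run n f)"

datatype oracle_call = SampCall | MQCall "bool list"

text \<open>The sequence of calls made when membership queries are answered by \<open>f\<close> and the
  successive calls to the sampling oracle return the successive elements of \<open>s\<close>.\<close>

primrec calls :: "(bool list \<Rightarrow> bool) \<Rightarrow> strategy \<Rightarrow> bool list stream \<Rightarrow> oracle_call list" where
  "calls f (Output b) s = []"
| "calls f (Samp k) s = SampCall # calls f (k (shd s)) (stl s)"
| "calls f (MQ x k) s = MQCall x # calls f (k (f x)) s"

definition well_formed :: "nat \<Rightarrow> algorithm \<Rightarrow> bool" where
  "well_formed n A \<longleftrightarrow>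
     (\<forall>t\<in>set_pmf A. \<forall>f\<in>bool_funs n. \<forall>s\<in>streams (ones n f).
        \<forall>x. MQCall x \<in> set (calls f t s) \<longrightarrow> x \<in> cube n)"

text \<open>Once the coins and the samples are fixed, the calls made do not depend on the answers
  to membership queries. Queries may depend on the samples drawn.\<close>

definition non_adaptive :: "nat \<Rightarrow> algorithm \<Rightarrow> bool" where
  "non_adaptive n A \<longleftrightarrow>
     (\<forall>t\<in>set_pmf A. \<forall>s\<in>streams (cube n). \<forall>f\<in>bool_funs n. \<forall>g\<in>bool_funs n.
        calls f t s = calls g t s)"

definition makes_at_most_calls :: "nat \<Rightarrow> algorithm \<Rightarrow> real \<Rightarrow> bool" where
  "makes_at_most_calls n A q \<longleftrightarrow>
     (\<forall>t\<in>set_pmf A. \<forall>f\<in>bool_funs n. \<forall>s\<in>streams (ones n f).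
        real (length (calls f t s)) \<le> q)"

definition rel_error_tester ::
    "nat \<Rightarrow> (bool list \<Rightarrow> bool) set \<Rightarrow> real \<Rightarrow> algorithm \<Rightarrow> bool" where
  "rel_error_tester n C \<epsilon> A \<longleftrightarrow>
     (\<forall>f\<in>bool_funs n. ones n f \<noteq> {} \<longrightarrow>
        (f \<in> C \<longrightarrow> pmf (verdict n f A) True \<ge> 2 / 3) \<and>
        (rel_dist_class n f C \<ge> \<epsilon> \<longrightarrow> pmf (verdict n f A) False \<ge> 2 / 3))"

definition one_sided :: "nat \<Rightarrow> (bool list \<Rightarrow> bool) set \<Rightarrow> algorithm \<Rightarrow> bool" where
  "one_sided n C A \<longleftrightarrow>
     (\<forall>f\<in>C. ones n f \<noteq> {} \<longrightarrow> pmf (verdict n f A) True = 1)"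

end

theory Submission
  imports Defs
begin

text \<open>Write \<open>F\<close> for the set of satisfying points. A round draws \<open>w, x, y\<close> from \<open>F\<close> and a uniform
  mask \<open>r\<close>, and queries \<open>y + ((x + w) \<and> r)\<close>; if \<open>F\<close> is a subcube, the answer is always positive.
  Conversely, let a round fail with probability \<open>p < 1/100\<close>, and fix a \<open>w\<close> for which the failure
  probability is at most \<open>p\<close>. Call \<open>moved d\<close> the number of \<open>y \<in> F\<close> with \<open>y + d \<notin> F\<close>. As \<open>moved\<close> is
  subadditive and \<open>d = (d \<and> r) + (d \<and> \<not> r)\<close>, the average of \<open>moved (x + w)\<close> over \<open>x \<in> F\<close> is at most
  \<open>2 p |F|\<close>. Hence the directions moving at most a fifth of \<open>F\<close> form a group \<open>H\<close>, and \<open>H + w\<close> differs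
  from \<open>F\<close> in at most \<open>45/2 p |F|\<close> points. If \<open>H\<close> were not closed under masking, then
  \<open>(x + w) \<and> r\<close> would leave \<open>H\<close> with constant probability, contradicting the bound on \<open>p\<close>;
  so \<open>H + w\<close> is a subcube. Thus \<open>O(1/\<epsilon>)\<close> independent rounds suffice.\<close>

section \<open>Bitwise sums and masks on the cube\<close>

definition vxor :: "bool list \<Rightarrow> bool list \<Rightarrow> bool list" where
  "vxor = map2 (\<noteq>)"

definition vand :: "bool list \<Rightarrow> bool list \<Rightarrow> bool list" where
  "vand = map2 (\<and>)"

lemma in_cube_iff [simp]: "x \<in> cube n \<longleftrightarrow> length x = n"
  by (simp add: cube_def)

lemma finite_cube [simp]: "finite (cube n)"
  using finite_lists_length_eq[of "UNIV :: bool set" n] by (simp add: cube_def)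

lemma cube_nonempty [simp]: "cube n \<noteq> {}"
  by (metis empty_iff in_cube_iff length_replicate)

lemma length_vxor [simp]: "length (vxor x y) = min (length x) (length y)"
  and length_vand [simp]: "length (vand x y) = min (length x) (length y)"
  by (simp_all add: vxor_def vand_def)

lemma nth_vxor [simp]:
    "i < length x \<Longrightarrow> i < length y \<Longrightarrow> vxor x y ! i \<longleftrightarrow> x ! i \<noteq> y ! i"
  and nth_vand [simp]:
    "i < length x \<Longrightarrow> i < length y \<Longrightarrow> vand x y ! i \<longleftrightarrow> x ! i \<and> y ! i"
  by (simp_all add: vxor_def vand_def)

lemma vxor_commute: "vxor x y = vxor y x"
  by (auto simp: list_eq_iff_nth_eq)

lemma vxor_assoc: "vxor (vxor x y) z = vxor x (vxor y z)"
  by (auto simp: list_eq_iff_nth_eq)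

lemma vxor_left_commute: "vxor x (vxor y z) = vxor y (vxor x z)"
  by (metis vxor_assoc vxor_commute)

lemma vxor_cancel [simp]: "length x = length y \<Longrightarrow> vxor x (vxor x y) = y"
  by (auto simp: list_eq_iff_nth_eq)

lemma vxor_cancel2 [simp]: "length x = length y \<Longrightarrow> vxor (vxor x y) y = x"
  by (auto simp: list_eq_iff_nth_eq)

lemma inj_on_vxor:
  assumes "A \<subseteq> cube n" and "d \<in> cube n"
  shows "inj_on (\<lambda>x. vxor x d) A"
  by (rule inj_on_inverseI[of _ "\<lambda>z. vxor z d"]) (use assms in auto)

lemma vand_vxor_left:
  "length x = n \<Longrightarrow> length y = n \<Longrightarrow> length r = n \<Longrightarrow>
     vand (vxor x y) r = vxor (vand x r) (vand y r)"
  by (auto simp: list_eq_iff_nth_eq)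

lemma vand_vxor_right:
  "length x = n \<Longrightarrow> length r = n \<Longrightarrow> length s = n \<Longrightarrow>
     vand x (vxor r s) = vxor (vand x r) (vand x s)"
  by (auto simp: list_eq_iff_nth_eq)

lemma vand_complement:
  "length x = length r \<Longrightarrow> vxor (vand x r) (vand x (map Not r)) = x"
  by (auto simp: list_eq_iff_nth_eq)

text \<open>An element \<open>h\<close> of \<open>H\<close> outside \<open>A\<close> yields a
  translate of \<open>A\<close> that lies in \<open>H\<close> and misses \<open>A\<close>.\<close>

lemma card_proper_subgroup:
  assumes H: "H \<subseteq> cube n" and A: "A \<subset> H"
    and cl: "\<And>x y. x \<in> H \<Longrightarrow> y \<in> H \<Longrightarrow> vxor x y \<in> H"
    and clA: "\<And>x y. x \<in> A \<Longrightarrow> y \<in> A \<Longrightarrow> vxor x y \<in> A"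
  shows "2 * card A \<le> card H"
proof -
  have fin: "finite H" using H finite_subset finite_cube by blast
  obtain h where h: "h \<in> H" "h \<notin> A" using A by blast
  have "vxor a h \<in> H - A" if "a \<in> A" for a
  proof -
    have "a \<in> cube n" "h \<in> cube n" using that h A H by blast+
    then have "vxor a (vxor a h) = h" by (intro vxor_cancel) simp
    moreover have "vxor a h \<in> H" using cl that h A by blast
    moreover have "vxor a (vxor a h) \<in> A" if "vxor a h \<in> A" using clA \<open>a \<in> A\<close> that .
    ultimately show ?thesis using h by auto
  qed
  then have "(\<lambda>a. vxor a h) ` A \<subseteq> H - A" by blast
  moreover have "inj_on (\<lambda>a. vxor a h) A" using A H h by (intro inj_on_vxor[of _ n]) blast+
  ultimately have "card A \<le> card (H - A)" using fin by (metis card_inj_on_le finite_Diff)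
  also have "\<dots> = card H - card A" using A fin
    by (meson card_Diff_subset finite_subset psubset_imp_subset)
  finally show ?thesis using A fin psubset_card_mono by fastforce
qed

section \<open>Points moved by a direction\<close>

definition moved :: "bool list set \<Rightarrow> bool list \<Rightarrow> nat" where
  "moved F d = card {y \<in> F. vxor y d \<notin> F}"

text \<open>A point \<open>y\<close> moved by the sum is moved by \<open>d\<close>, or else
  \<open>vxor y d\<close> is still in \<open>F\<close> and is moved by \<open>e\<close>; translation
  by \<open>d\<close> is injective.\<close>

lemma moved_vxor_le:
  assumes F: "F \<subseteq> cube n" and d: "d \<in> cube n" and e: "e \<in> cube n"
  shows "moved F (vxor d e) \<le> moved F d + moved F e"
proof -
  have fin: "finite F" using F finite_subset finite_cube by blast
  let ?B = "{y \<in> F. vxor y d \<in> F \<and> vxor (vxor y d) e \<notin> F}"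
  have "{y \<in> F. vxor y (vxor d e) \<notin> F} \<subseteq> {y \<in> F. vxor y d \<notin> F} \<union> ?B"
    by (auto simp: vxor_assoc)
  then have "moved F (vxor d e) \<le> card ({y \<in> F. vxor y d \<notin> F} \<union> ?B)"
    unfolding moved_def using fin by (intro card_mono) auto
  also have "\<dots> \<le> moved F d + card ?B" unfolding moved_def by (rule card_Un_le)
  also have "card ?B \<le> moved F e"
    unfolding moved_def
    by (rule card_inj_on_le[where f = "\<lambda>y. vxor y d"])
       (use fin F d in \<open>auto intro!: inj_on_vxor\<close>)
  finally show ?thesis by simp
qed

text \<open>Each mask splits \<open>v\<close> into the parts under the mask and under its
  complement. Complementing permutes the masks, so both parts have the same total, hence the factor
  2.\<close>

lemma moved_le_sum_vand:
  assumes F: "F \<subseteq> cube n" and v: "v \<in> cube n"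
  shows "card (cube n) * moved F v \<le> 2 * (\<Sum>r\<in>cube n. moved F (vand v r))"
proof -
  have "card (cube n) * moved F v = (\<Sum>r\<in>cube n. moved F v)" by simp
  also have "\<dots> \<le> (\<Sum>r\<in>cube n. moved F (vand v r) + moved F (vand v (map Not r)))"
  proof (rule sum_mono)
    fix r assume "r \<in> cube n"
    then show "moved F v \<le> moved F (vand v r) + moved F (vand v (map Not r))"
      using moved_vxor_le[OF F, of "vand v r" "vand v (map Not r)"] v
      by (simp add: vand_complement)
  qed
  also have "\<dots> = (\<Sum>r\<in>cube n. moved F (vand v r)) + (\<Sum>r\<in>cube n. moved F (vand v (map Not r)))"
    by (rule sum.distrib)
  also have "(\<Sum>r\<in>cube n. moved F (vand v (map Not r))) = (\<Sum>r\<in>cube n. moved F (vand v r))"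
    by (rule sum.reindex_bij_witness[of _ "map Not" "map Not"]) (auto simp: comp_def)
  finally show ?thesis by simp
qed

lemma markov_card:
  fixes g :: "'a \<Rightarrow> real"
  assumes "finite A" and "\<And>x. x \<in> A \<Longrightarrow> 0 \<le> g x"
  shows "real (card {x \<in> A. g x > t}) * t \<le> sum g A"
proof -
  have "real (card {x \<in> A. g x > t}) * t = (\<Sum>x\<in>{x \<in> A. g x > t}. t)" by simp
  also have "\<dots> \<le> (\<Sum>x\<in>{x \<in> A. g x > t}. g x)" by (rule sum_mono) auto
  also have "\<dots> \<le> sum g A" using assms by (intro sum_mono2) auto
  finally show ?thesis .
qed

text \<open>\<open>S\<close> holds the free coordinates; every other coordinate below
  \<open>n\<close> contributes one literal, its sign read off from \<open>w\<close>.\<close>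

lemma ex_conjunction_subcube:
  "\<exists>g\<in>conjunctions n. ones n g = {z \<in> cube n. \<forall>i<n. i \<notin> S \<longrightarrow> z ! i = w ! i}"
proof -
  define lit where "lit i = (if w ! i then Pos i else Neg i)" for i
  define ls where "ls = map lit (filter (\<lambda>i. i \<notin> S) [0..<n])"
  define g where "g = restrict (\<lambda>x. \<forall>l\<in>set ls. lit_holds l x) (cube n)"
  have lit: "lit_holds (lit i) z \<longleftrightarrow> z ! i = w ! i" "var (lit i) = i" for i z
    by (auto simp: lit_def)
  have "(\<forall>l\<in>set ls. lit_holds l z) \<longleftrightarrow> (\<forall>i<n. i \<notin> S \<longrightarrow> z ! i = w ! i)" for z
    by (auto simp: ls_def lit)
  then have "ones n g = {z \<in> cube n. \<forall>i<n. i \<notin> S \<longrightarrow> z ! i = w ! i}"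
    unfolding ones_def g_def by auto
  moreover have "g \<in> conjunctions n"
    unfolding conjunctions_def g_def by (intro CollectI exI[of _ ls]) (auto simp: ls_def lit)
  ultimately show ?thesis by blast
qed

section \<open>Sets with small rejection probability are close to a subcube\<close>

text \<open>With \<open>w\<close> fixed, \<open>rej\<close> bounds by \<open>p\<close> the failure
  probability of a round over uniform \<open>x\<close>, \<open>y\<close> and \<open>r\<close>, with
  denominators cleared.\<close>

locale small_rejection =
  fixes n :: nat and F :: "bool list set" and w :: "bool list" and p :: real
  assumes F: "F \<subseteq> cube n" and w: "w \<in> F" and p: "p < 1 / 100"
    and rej: "(\<Sum>x\<in>F. \<Sum>r\<in>cube n. real (moved F (vand (vxor x w) r)))
                \<le> p * real (card F) ^ 2 * real (card (cube n))"
begin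

lemma finite_F [simp]: "finite F"
  using F finite_subset finite_cube by blast

lemma length_F [simp]: "x \<in> F \<Longrightarrow> length x = n"
  using F by auto

lemma length_w [simp]: "length w = n"
  using w by simp

lemma card_F_pos: "real (card F) > 0"
  using w finite_F by (metis card_gt_0_iff empty_iff of_nat_0_less_iff)

lemma card_cube_pos: "real (card (cube n)) > 0"
  by (simp add: card_gt_0_iff)

lemma sum_moved: "(\<Sum>x\<in>F. real (moved F (vxor x w))) \<le> 2 * p * real (card F) ^ 2"
proof -
  have "real (card (cube n)) * (\<Sum>x\<in>F. real (moved F (vxor x w)))
      = (\<Sum>x\<in>F. real (card (cube n) * moved F (vxor x w)))"
    by (simp add: sum_distrib_left)
  also have "\<dots> \<le> (\<Sum>x\<in>F. real (2 * (\<Sum>r\<in>cube n. moved F (vand (vxor x w) r))))"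
    by (intro sum_mono of_nat_mono moved_le_sum_vand F) auto
  also have "\<dots> = 2 * (\<Sum>x\<in>F. \<Sum>r\<in>cube n. real (moved F (vand (vxor x w) r)))"
    by (simp add: sum_distrib_left)
  also have "\<dots> \<le> 2 * (p * real (card F) ^ 2 * real (card (cube n)))"
    using rej by simp
  also have "\<dots> = real (card (cube n)) * (2 * p * real (card F) ^ 2)" by simp
  finally show ?thesis using mult_le_cancel_left_pos[OF card_cube_pos] by blast
qed

text \<open>Markov's inequality at a tenth of \<open>card F\<close> turns the mean bound
  \<open>2 * p\<close> into \<open>20 * p\<close>.\<close>

lemma card_far:
  "real (card {x \<in> F. real (moved F (vxor x w)) > real (card F) / 10}) \<le> 20 * p * real (card F)"
    (is "?c \<le> _")
proof -
  have "?c * (real (card F) / 10) \<le> 2 * p * real (card F) ^ 2"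
    by (rule order_trans[OF markov_card[OF finite_F] sum_moved]) simp
  then have "?c * real (card F) \<le> (20 * p * real (card F)) * real (card F)"
    unfolding power2_eq_square by linarith
  then show ?thesis using mult_le_cancel_right_pos[OF card_F_pos] by blast
qed

text \<open>A fifth is twice the tenth of \<open>card_far\<close> and half of the two fifths allowed
  in \<open>gap\<close>.\<close>

definition H :: "bool list set" where
  "H = {h \<in> cube n. real (moved F h) \<le> real (card F) / 5}"

lemma card_stay: "real (card {y \<in> F. vxor y h \<in> F}) = real (card F) - real (moved F h)"
proof -
  have "card F = card ({y \<in> F. vxor y h \<in> F} \<union> {y \<in> F. vxor y h \<notin> F})"
    by (rule arg_cong[where f = card]) auto
  also have "\<dots> = card {y \<in> F. vxor y h \<in> F} + moved F h"
    unfolding moved_def by (rule card_Un_disjoint) auto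
  finally show ?thesis by simp
qed

text \<open>A direction \<open>h\<close> moving at most two fifths of \<open>F\<close> is a sum \<open>(y + w) + (y + h + w)\<close> of two
  typical directions, which move at most a tenth of \<open>F\<close> each.\<close>

lemma gap:
  assumes h: "h \<in> cube n" and le: "real (moved F h) \<le> 2 / 5 * real (card F)"
  shows "h \<in> H"
proof -
  define B where "B = {x \<in> F. real (moved F (vxor x w)) > real (card F) / 10}"
  define B' where "B' = {y \<in> F. vxor y h \<in> B}"
  have B: "real (card B) \<le> 20 * p * real (card F)"
    unfolding B_def by (rule card_far)
  have fB: "finite B" "finite B'" by (auto simp: B_def B'_def)
  have "card B' \<le> card B"
    by (rule card_inj_on_le[where f = "\<lambda>y. vxor y h"])
       (use F h fB in \<open>auto simp: B'_def intro!: inj_on_vxor\<close>)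
  then have "real (card (B \<union> B')) \<le> 40 * p * real (card F)"
    using B card_Un_le[of B B'] by linarith
  \<comment> \<open>Here \<open>40 * p\<close> is below 2/5, while at least 3/5 of \<open>F\<close>
    stays in \<open>F\<close> under \<open>h\<close>; so a suitable \<open>y\<close> exists.\<close>
  also have "\<dots> < 3 / 5 * real (card F)"
    using p card_F_pos by (intro mult_strict_right_mono) auto
  also have "\<dots> \<le> real (card {y \<in> F. vxor y h \<in> F})"
    using le card_stay[of h] by simp
  finally have "card (B \<union> B') < card {y \<in> F. vxor y h \<in> F}" by simp
  then have "\<not> {y \<in> F. vxor y h \<in> F} \<subseteq> B \<union> B'"
    using card_mono[of "B \<union> B'" "{y \<in> F. vxor y h \<in> F}"] fB by auto
  then obtain y where y: "y \<in> F" "vxor y h \<in> F" "y \<notin> B" "vxor y h \<notin> B"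
    by (auto simp: B'_def)
  let ?a = "vxor y w" and ?b = "vxor (vxor y h) w"
  have "length y = n" "length h = n" using y h by auto
  then have "vxor ?a ?b = h" by (auto simp: list_eq_iff_nth_eq)
  then have "moved F h \<le> moved F ?a + moved F ?b"
    using moved_vxor_le[OF F, of ?a ?b] y h by simp
  moreover have "real (moved F ?a) \<le> real (card F) / 10" "real (moved F ?b) \<le> real (card F) / 10"
    using y by (auto simp: B_def)
  ultimately show ?thesis using h by (simp add: H_def)
qed

lemma H_cube: "H \<subseteq> cube n"
  by (auto simp: H_def)

lemma length_H: "h \<in> H \<Longrightarrow> length h = n"
  by (auto simp: H_def)

lemma finite_H [simp]: "finite H"
  using H_cube finite_subset finite_cube by blast

text \<open>Subadditivity only gives two fifths; \<open>gap\<close> brings this back to a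
  fifth.\<close>

lemma H_vxor:
  assumes "a \<in> H" and "b \<in> H"
  shows "vxor a b \<in> H"
proof (rule gap)
  show "vxor a b \<in> cube n" using assms by (simp add: length_H)
  have "moved F (vxor a b) \<le> moved F a + moved F b"
    using assms H_cube by (intro moved_vxor_le[OF F]) auto
  moreover have "real (moved F a) \<le> real (card F) / 5" "real (moved F b) \<le> real (card F) / 5"
    using assms by (simp_all add: H_def)
  ultimately show "real (moved F (vxor a b)) \<le> 2 / 5 * real (card F)" by linarith
qed

text \<open>The coset of \<open>H\<close> through \<open>w\<close>, which turns out to be the
  approximating subcube.\<close>

definition C :: "bool list set" where
  "C = {z \<in> cube n. vxor z w \<in> H}"

lemma length_C: "z \<in> C \<Longrightarrow> length z = n"
  by (auto simp: C_def)

lemma finite_C [simp]: "finite C"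
  by (rule finite_subset[OF _ finite_cube[of n]]) (auto simp: C_def)

lemma card_C: "card C = card H"
proof (rule bij_betw_same_card[of "\<lambda>z. vxor z w"], rule bij_betwI[where g = "\<lambda>z. vxor z w"])
  show "(\<lambda>z. vxor z w) \<in> C \<rightarrow> H" "(\<lambda>z. vxor z w) \<in> H \<rightarrow> C"
    by (auto simp: C_def length_H)
qed (auto simp: length_C length_H)

lemma card_F_minus_C: "real (card (F - C)) \<le> 20 * p * real (card F)"
proof -
  have "F - C \<subseteq> {x \<in> F. real (moved F (vxor x w)) > real (card F) / 10}"
    using card_F_pos by (auto simp: C_def H_def)
  then have "card (F - C) \<le> card {x \<in> F. real (moved F (vxor x w)) > real (card F) / 10}"
    by (intro card_mono) auto
  then show ?thesis using card_far by linarith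
qed

text \<open>Double counting of the pairs of \<open>z\<close> in \<open>C - F\<close> and
  \<open>x\<close> in \<open>F\<close> with \<open>vxor x (vxor z w)\<close> in \<open>F\<close>.
  Each \<open>z\<close> has at least 4/5 of \<open>F\<close> as partners; for each \<open>x\<close>,
  translation by \<open>vxor x w\<close> injects its partners into the points moved by that
  direction.\<close>

lemma card_C_minus_F: "real (card (C - F)) \<le> 5 / 2 * p * real (card F)"
proof -
  have "real (card (C - F)) * (4 / 5 * real (card F)) = (\<Sum>z\<in>C - F. 4 / 5 * real (card F))"
    by simp
  also have "\<dots> \<le> (\<Sum>z\<in>C - F. real (card {x \<in> F. vxor x (vxor z w) \<in> F}))"
    by (rule sum_mono) (auto simp: card_stay C_def H_def)
  also have "\<dots> = real (\<Sum>z\<in>C - F. card {x \<in> F. vxor x (vxor z w) \<in> F})" by simp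
  also have "(\<Sum>z\<in>C - F. card {x \<in> F. vxor x (vxor z w) \<in> F})
      = (\<Sum>x\<in>F. card {z \<in> C - F. vxor x (vxor z w) \<in> F})"
    by (rule sum_multicount_gen[symmetric]) auto
  also have "real \<dots> \<le> real (\<Sum>x\<in>F. moved F (vxor x w))"
  proof (intro of_nat_mono sum_mono)
    fix x assume x: "x \<in> F"
    show "card {z \<in> C - F. vxor x (vxor z w) \<in> F} \<le> moved F (vxor x w)"
      unfolding moved_def
      by (intro card_inj_on_le[where f = "\<lambda>z. vxor z (vxor x w)"])
         (use x in \<open>auto simp: vxor_left_commute[of x] length_C intro!: inj_on_vxor[of _ n]\<close>)
  qed
  also have "\<dots> \<le> 2 * p * real (card F) ^ 2" using sum_moved by simp
  finally have "real (card (C - F)) * real (card F) \<le> (5 / 2 * p * real (card F)) * real (card F)"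
    unfolding power2_eq_square by linarith
  then show ?thesis using mult_le_cancel_right_pos[OF card_F_pos] by blast
qed

text \<open>If the group \<open>H\<close> were not closed under intersection with arbitrary masks, two
  successive proper subgroups (of index at least 2) would make a quarter of the pairs
  \<open>(x, r)\<close> leave \<open>H\<close>, and each of these is rejected with constant probability.\<close>

lemma H_vand:
  assumes "h \<in> H" and "r \<in> cube n"
  shows "vand h r \<in> H"
proof (rule ccontr)
  assume contra: "vand h r \<notin> H"
  \<comment> \<open>The part of \<open>H\<close> that stays in \<open>H\<close> under every mask; it
    is a subgroup because masking is linear in \<open>x\<close>.\<close>
  define A where "A = {x \<in> H. \<forall>r\<in>cube n. vand x r \<in> H}"
  have "A \<subset> H" using assms contra unfolding A_def by blast
  moreover have "vxor x y \<in> A" if "x \<in> A" "y \<in> A" for x y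
    using that H_vxor by (auto simp: A_def vand_vxor_left[of _ n] length_H)
  ultimately have A: "2 * card A \<le> card H"
    using H_vxor by (intro card_proper_subgroup[OF H_cube]) auto
  define E where "E = {x \<in> F \<inter> C. vxor x w \<notin> A}"
  \<comment> \<open>At most half of \<open>C\<close> lies over \<open>A\<close>, so twice
    \<open>card E\<close> is at least \<open>card F\<close> minus the symmetric difference of
    \<open>F\<close> and \<open>C\<close>. The loss \<open>45/4 * p\<close> is rounded up to
    \<open>25/2 * p\<close>.\<close>
  have E: "real (card E) \<ge> (1 / 2 - 25 / 2 * p) * real (card F)"
  proof -
    let ?A = "(\<lambda>z. vxor z w) ` A"
    have "C \<subseteq> E \<union> (C - F) \<union> ?A"
    proof
      fix z assume z: "z \<in> C"
      have "z = vxor (vxor z w) w" using z by (simp add: length_C)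
      then show "z \<in> E \<union> (C - F) \<union> ?A" using z by (auto simp: E_def)
    qed
    moreover have "finite A" by (simp add: A_def)
    ultimately have "card C \<le> card (E \<union> (C - F) \<union> ?A)"
      by (intro card_mono) (auto simp: E_def)
    also have "\<dots> \<le> card E + card (C - F) + card ?A"
      by (meson add_le_mono card_Un_le order_refl order_trans)
    also have "card ?A \<le> card A" by (rule card_image_le) (simp add: A_def)
    finally have "2 * card E + 2 * card (C - F) \<ge> card C" using A card_C by linarith
    moreover have "card F + card (C - F) = card C + card (F - C)"
    proof -
      have "card F + card (C - F) = card (F \<union> C)" by (subst card_Un_disjoint[symmetric]) auto
      also have "F \<union> C = C \<union> (F - C)" by auto
      also have "card (C \<union> (F - C)) = card C + card (F - C)" by (rule card_Un_disjoint) auto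
      finally show ?thesis .
    qed
    ultimately have "2 * card E + card (C - F) + card (F - C) \<ge> card F" by linarith
    then show ?thesis using card_F_minus_C card_C_minus_F by (simp add: algebra_simps)
  qed
  have one: "(\<Sum>r\<in>cube n. real (moved F (vand (vxor x w) r)))
      \<ge> real (card (cube n)) * real (card F) / 10" if x: "x \<in> E" for x
  proof -
    \<comment> \<open>Masking is also linear in the mask, so \<open>R\<close> is a proper subgroup
      of the cube: at least half of the masks lead outside \<open>H\<close>, each moving more than a
      fifth of \<open>F\<close>.\<close>
    define R where "R = {r \<in> cube n. vand (vxor x w) r \<in> H}"
    have xE: "x \<in> F" "vxor x w \<in> H" "vxor x w \<notin> A" using x by (auto simp: E_def C_def)
    then have "R \<subset> cube n" by (auto simp: A_def R_def)
    moreover have "vxor s t \<in> R" if "s \<in> R" "t \<in> R" for s t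
      using that H_vxor xE by (auto simp: R_def vand_vxor_right[of _ n])
    ultimately have "2 * card R \<le> card (cube n)"
      by (intro card_proper_subgroup) auto
    then have "card (cube n) \<le> 2 * card (cube n - R)"
      using \<open>R \<subset> cube n\<close> by (subst card_Diff_subset) (auto intro: finite_subset)
    then have "real (card (cube n)) \<le> 2 * real (card (cube n - R))" by linarith
    then have "real (card (cube n)) * real (card F) / 10
        \<le> 2 * real (card (cube n - R)) * real (card F) / 10"
      by (intro divide_right_mono mult_right_mono) auto
    also have "\<dots> = (\<Sum>r\<in>cube n - R. real (card F) / 5)" by simp
    also have "\<dots> \<le> (\<Sum>r\<in>cube n - R. real (moved F (vand (vxor x w) r)))"
      using xE by (intro sum_mono) (auto simp: R_def H_def)
    also have "\<dots> \<le> (\<Sum>r\<in>cube n. real (moved F (vand (vxor x w) r)))"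
      by (rule sum_mono2) auto
    finally show ?thesis .
  qed
  have "real (card E) * (real (card (cube n)) * real (card F) / 10)
      = (\<Sum>x\<in>E. real (card (cube n)) * real (card F) / 10)" by simp
  also have "\<dots> \<le> (\<Sum>x\<in>E. \<Sum>r\<in>cube n. real (moved F (vand (vxor x w) r)))"
    by (intro sum_mono one)
  also have "\<dots> \<le> (\<Sum>x\<in>F. \<Sum>r\<in>cube n. real (moved F (vand (vxor x w) r)))"
    by (rule sum_mono2) (auto simp: E_def intro: sum_nonneg)
  also note rej
  finally have "real (card E) * (real (card F) * real (card (cube n)))
      \<le> (10 * p * real (card F)) * (real (card F) * real (card (cube n)))"
    unfolding power2_eq_square by argo
  then have "real (card E) \<le> 10 * p * real (card F)"
    using mult_le_cancel_right_pos[OF mult_pos_pos[OF card_F_pos card_cube_pos]] by blast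
  then have "(1 / 2 - 25 / 2 * p) * real (card F) \<le> (10 * p) * real (card F)"
    using E by linarith
  \<comment> \<open>This forces \<open>p\<close> to be at least 1/45.\<close>
  then have "1 / 2 - 25 / 2 * p \<le> 10 * p" using mult_le_cancel_right_pos[OF card_F_pos] by blast
  then show False using p by simp
qed

definition S :: "nat set" where
  "S = {i. \<exists>h\<in>H. i < n \<and> h ! i}"

text \<open>Masking a witness \<open>h\<close> for \<open>j\<close> in \<open>S\<close> down to the
  coordinate \<open>j\<close> puts the unit vector at \<open>j\<close> into \<open>H\<close>; sums
  of these give all indicators.\<close>

lemma indicator_in_H:
  assumes "finite T" and "T \<subseteq> S"
  shows "map (\<lambda>i. i \<in> T) [0..<n] \<in> H"
  using assms
proof (induction T rule: finite_induct)
  case empty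
  have "vxor y (map (\<lambda>i. False) [0..<n]) = y" if "y \<in> F" for y
    using that by (auto simp: list_eq_iff_nth_eq)
  then have "moved F (map (\<lambda>i. False) [0..<n]) = 0" by (auto simp: moved_def)
  then show ?case by (simp add: H_def)
next
  case (insert j T)
  obtain h where h: "h \<in> H" "j < n" "h ! j" using insert.prems by (auto simp: S_def)
  have "vand h (map (\<lambda>i. i = j) [0..<n]) \<in> H" using h by (intro H_vand) auto
  moreover have "map (\<lambda>i. i \<in> insert j T) [0..<n]
      = vxor (map (\<lambda>i. i \<in> T) [0..<n]) (vand h (map (\<lambda>i. i = j) [0..<n]))"
    using h insert.hyps by (auto simp: list_eq_iff_nth_eq length_H)
  ultimately show ?case using insert H_vxor by simp
qed

text \<open>Elements of \<open>H\<close> vanish off \<open>S\<close>; conversely, a difference from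
  \<open>w\<close> supported on \<open>S\<close> is an indicator and lies in
  \<open>H\<close>.\<close>

lemma C_eq: "C = {z \<in> cube n. \<forall>i<n. i \<notin> S \<longrightarrow> z ! i = w ! i}"
proof (intro equalityI subsetI)
  fix z assume "z \<in> C"
  then show "z \<in> {z \<in> cube n. \<forall>i<n. i \<notin> S \<longrightarrow> z ! i = w ! i}"
    by (auto simp: C_def S_def dest!: bspec)
next
  fix z assume z: "z \<in> {z \<in> cube n. \<forall>i<n. i \<notin> S \<longrightarrow> z ! i = w ! i}"
  define T where "T = {i. i < n \<and> z ! i \<noteq> w ! i}"
  have "map (\<lambda>i. i \<in> T) [0..<n] \<in> H"
    using z by (intro indicator_in_H) (auto simp: T_def)
  moreover have "map (\<lambda>i. i \<in> T) [0..<n] = vxor z w"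
    using z by (auto simp: list_eq_iff_nth_eq T_def)
  ultimately show "z \<in> C" using z by (simp add: C_def)
qed

lemma card_sym_diff: "real (card ((F - C) \<union> (C - F))) \<le> 45 / 2 * p * real (card F)"
  using card_Un_le[of "F - C" "C - F"] card_F_minus_C card_C_minus_F by linarith

end

section \<open>Rejection probability of a round and distance to the class\<close>

text \<open>\<open>moved\<close> counts the failing \<open>y\<close>, and the denominator counts all
  choices of \<open>w\<close>, \<open>x\<close>, \<open>y\<close> and \<open>r\<close>.\<close>

definition reject_prob :: "nat \<Rightarrow> bool list set \<Rightarrow> real" where
  "reject_prob n F = (\<Sum>w\<in>F. \<Sum>x\<in>F. \<Sum>r\<in>cube n. real (moved F (vand (vxor x w) r)))
     / (real (card F) ^ 3 * real (card (cube n)))"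

lemma ones_cube: "ones n f \<subseteq> cube n"
  by (auto simp: ones_def)

lemma finite_ones [simp]: "finite (ones n f)"
  by (rule finite_subset[OF ones_cube finite_cube])

lemma ones_length: "x \<in> ones n f \<Longrightarrow> length x = n"
  by (simp add: ones_def)

text \<open>By averaging, some \<open>w\<close> has conditional failure probability at most the
  overall one.\<close>

lemma ex_small_rejection:
  assumes F: "F \<subseteq> cube n" "F \<noteq> {}" and p: "reject_prob n F < 1 / 100"
  shows "\<exists>w. small_rejection n F w (reject_prob n F)"
proof -
  have fin: "finite F" using F finite_subset finite_cube by blast
  define g where "g w = (\<Sum>x\<in>F. \<Sum>r\<in>cube n. real (moved F (vand (vxor x w) r)))" for w
  define b where "b = reject_prob n F * real (card F) ^ 2 * real (card (cube n))"
  have pos: "real (card F) > 0" "real (card (cube n)) > 0"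
    using F fin by (simp_all add: card_gt_0_iff)
  have cancel: "N * (s / (N ^ 3 * M) * N ^ 2 * M) = s" if "N > 0" "M > 0" for s N M :: real
    using that by (simp add: power3_eq_cube power2_eq_square)
  have reject: "reject_prob n F = sum g F / (real (card F) ^ 3 * real (card (cube n)))"
    unfolding reject_prob_def g_def ..
  have eq: "real (card F) * b = sum g F"
    unfolding b_def reject by (rule cancel[OF pos])
  have "\<exists>w\<in>F. g w \<le> b"
  proof (rule ccontr)
    assume "\<not> ?thesis"
    then have "(\<Sum>w\<in>F. b) < sum g F"
      using F(2) by (intro sum_strict_mono fin) (simp_all add: not_le)
    then show False using eq by simp
  qed
  then obtain w where "w \<in> F" "g w \<le> b" by blast
  then show ?thesis
    using F(1) p unfolding small_rejection_def b_def g_def by blast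
qed

lemma conjunctions_subset: "conjunctions n \<subseteq> bool_funs n"
  by (auto simp: conjunctions_def bool_funs_def)

text \<open>Extensionality on the finite cube gives finiteness, which makes the \<open>Min\<close>
  in \<open>rel_dist_class\<close> a true minimum.\<close>

lemma finite_conjunctions: "finite (conjunctions n)"
  by (rule finite_subset[OF conjunctions_subset])
     (unfold bool_funs_def, intro finite_PiE, auto)

lemma rel_dist_class_le:
  "g \<in> conjunctions n \<Longrightarrow> rel_dist_class n f (conjunctions n) \<le> rel_dist n f g"
  unfolding rel_dist_class_def by (intro Min_le finite_imageI finite_conjunctions) auto

lemma rel_dist_class_le_reject_prob:
  assumes "ones n f \<noteq> {}" and "reject_prob n (ones n f) < 1 / 100"
  shows "rel_dist_class n f (conjunctions n) \<le> 45 / 2 * reject_prob n (ones n f)"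
proof -
  obtain w where "small_rejection n (ones n f) w (reject_prob n (ones n f))"
    using ex_small_rejection[OF ones_cube] assms by blast
  then interpret small_rejection n "ones n f" w "reject_prob n (ones n f)" .
  obtain g where g: "g \<in> conjunctions n" "ones n g = C"
    using ex_conjunction_subcube[of n S w] unfolding C_eq by blast
  have "rel_dist n f g \<le> 45 / 2 * reject_prob n (ones n f)"
    unfolding rel_dist_def g(2) using card_sym_diff card_F_pos by (simp add: divide_le_eq)
  then show ?thesis using rel_dist_class_le[OF g(1)] by (rule order_trans[rotated])
qed

text \<open>The conjunction describing a single satisfying point already has relative distance below 1.\<close>

lemma rel_dist_class_less_one:
  assumes "ones n f \<noteq> {}"
  shows "rel_dist_class n f (conjunctions n) < 1"
proof -
  obtain w where w: "w \<in> ones n f" using assms by blast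
  obtain g where g: "g \<in> conjunctions n"
    "ones n g = {z \<in> cube n. \<forall>i<n. i \<notin> {} \<longrightarrow> z ! i = w ! i}"
    using ex_conjunction_subcube by blast
  have "ones n g = {w}"
    unfolding g(2) using ones_length[OF w] by (auto simp: list_eq_iff_nth_eq)
  then have "rel_dist n f g = real (card (ones n f - {w})) / real (card (ones n f))"
    using w by (simp add: rel_dist_def insert_absorb)
  also have "\<dots> < 1"
  proof -
    have "card (ones n f - {w}) < card (ones n f)" using w by (intro card_Diff1_less) auto
    then show ?thesis by (simp add: divide_less_eq)
  qed
  finally show ?thesis using rel_dist_class_le[OF g(1), of f] by simp
qed

text \<open>On a coordinate fixed by a literal, \<open>w\<close>, \<open>x\<close> and
  \<open>y\<close> agree, so the masked difference vanishes there and the queried point keeps the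
  bit of \<open>y\<close>.\<close>

lemma reject_prob_conjunction:
  assumes "f \<in> conjunctions n"
  shows "reject_prob n (ones n f) = 0"
proof -
  obtain ls where f: "f = restrict (\<lambda>x. \<forall>l\<in>set ls. lit_holds l x) (cube n)"
    and ls: "\<forall>l\<in>set ls. var l < n"
    using assms by (auto simp: conjunctions_def)
  have "vxor y (vand (vxor x w) r) \<in> ones n f"
    if "w \<in> ones n f" "x \<in> ones n f" "y \<in> ones n f" "r \<in> cube n" for w x y r
  proof -
    have "lit_holds l (vxor y (vand (vxor x w) r))" if l: "l \<in> set ls" for l
    proof -
      have "lit_holds l w" "lit_holds l x" "lit_holds l y" "var l < n"
        using that l ls \<open>w \<in> _\<close> \<open>x \<in> _\<close> \<open>y \<in> _\<close> by (auto simp: ones_def f)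
      then show ?thesis
        using \<open>w \<in> _\<close> \<open>x \<in> _\<close> \<open>y \<in> _\<close> \<open>r \<in> _\<close> by (cases l) (auto simp: ones_length)
    qed
    then show ?thesis using that by (auto simp: ones_def f)
  qed
  then have "moved (ones n f) (vand (vxor x w) r) = 0"
    if "w \<in> ones n f" "x \<in> ones n f" "r \<in> cube n" for w x r
    using that by (auto simp: moved_def)
  then show ?thesis by (simp add: reject_prob_def)
qed

section \<open>The tester and its acceptance probability\<close>

text \<open>The masks are the coins tossed at the outset. The flag \<open>b\<close> collects the
  answers, and the rounds continue after a negative one, which keeps the calls non-adaptive.\<close>

primrec rounds :: "bool list list \<Rightarrow> bool \<Rightarrow> strategy" where
  "rounds [] b = Output b"
| "rounds (r # rs) b = Samp (\<lambda>w. Samp (\<lambda>x. Samp (\<lambda>y.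
     MQ (vxor y (vand (vxor x w) r)) (\<lambda>c. rounds rs (b \<and> c)))))"

definition round_outcome :: "nat \<Rightarrow> (bool list \<Rightarrow> bool) \<Rightarrow> bool pmf" where
  "round_outcome n f = do {
     r \<leftarrow> pmf_of_set (cube n);
     w \<leftarrow> pmf_of_set (ones n f);
     x \<leftarrow> pmf_of_set (ones n f);
     y \<leftarrow> pmf_of_set (ones n f);
     return_pmf (f (vxor y (vand (vxor x w) r)))}"

lemma pmf_round_outcome_False:
  assumes ne: "ones n f \<noteq> {}"
  shows "pmf (round_outcome n f) False = reject_prob n (ones n f)"
proof -
  let ?F = "ones n f"
  have moved: "(\<Sum>y\<in>?F. pmf (return_pmf (f (vxor y (vand (vxor x w) r)))) False)
      = real (moved ?F (vand (vxor x w) r))"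
    if "w \<in> ?F" "x \<in> ?F" "r \<in> cube n" for w x r
  proof -
    \<comment> \<open>The queried point has length \<open>n\<close>, so a negative answer means
      exactly that it lies outside \<open>?F\<close>.\<close>
    have "(\<Sum>y\<in>?F. pmf (return_pmf (f (vxor y (vand (vxor x w) r)))) False)
        = (\<Sum>y\<in>?F. of_bool (vxor y (vand (vxor x w) r) \<notin> ?F))"
      using that by (intro sum.cong refl) (auto simp: ones_def)
    also have "\<dots> = real (moved ?F (vand (vxor x w) r))"
      by (simp add: moved_def of_bool_def sum.If_cases Int_def)
    finally show ?thesis .
  qed
  have "pmf (round_outcome n f) False =
     (\<Sum>r\<in>cube n. (\<Sum>w\<in>?F. (\<Sum>x\<in>?F. (\<Sum>y\<in>?F. pmf (return_pmf (f (vxor y (vand (vxor x w) r)))) False)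
        / card ?F) / card ?F) / card ?F) / card (cube n)"
    unfolding round_outcome_def
    by (simp only: pmf_bind_pmf_of_set[OF cube_nonempty finite_cube] pmf_bind_pmf_of_set[OF ne finite_ones])
  also have "\<dots> = (\<Sum>r\<in>cube n. \<Sum>w\<in>?F. \<Sum>x\<in>?F. \<Sum>y\<in>?F.
      (pmf (return_pmf (f (vxor y (vand (vxor x w) r)))) False))
      / (real (card ?F) ^ 3 * real (card (cube n)))"
    by (simp only: sum_divide_distrib[symmetric] power3_eq_cube divide_divide_eq_left mult_ac)
  also have "(\<Sum>r\<in>cube n. \<Sum>w\<in>?F. \<Sum>x\<in>?F. \<Sum>y\<in>?F.
      pmf (return_pmf (f (vxor y (vand (vxor x w) r)))) False)
      = (\<Sum>r\<in>cube n. (\<Sum>w\<in>?F. (\<Sum>x\<in>?F. real (moved ?F (vand (vxor x w) r)))))"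
    by (intro sum.cong refl moved)
  also have "(\<Sum>r\<in>cube n. (\<Sum>w\<in>?F. (\<Sum>x\<in>?F. real (moved ?F (vand (vxor x w) r)))))
      = (\<Sum>w\<in>?F. (\<Sum>r\<in>cube n. (\<Sum>x\<in>?F. real (moved ?F (vand (vxor x w) r)))))"
    by (rule sum.swap)
  also have "\<dots> = (\<Sum>w\<in>?F. (\<Sum>x\<in>?F. (\<Sum>r\<in>cube n. real (moved ?F (vand (vxor x w) r)))))"
    by (intro sum.cong refl sum.swap)
  finally show ?thesis by (simp add: reject_prob_def)
qed

lemma pmf_True: "pmf p True = 1 - pmf p False"
proof -
  have "(\<Sum>b\<in>UNIV. pmf p b) = 1" by (rule sum_pmf_eq_1) auto
  then show ?thesis by (simp add: UNIV_bool)
qed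

definition conj_tester :: "nat \<Rightarrow> nat \<Rightarrow> algorithm" where
  "conj_tester n k = map_pmf (\<lambda>rs. rounds rs True) (replicate_pmf k (pmf_of_set (cube n)))"

lemma set_conj_tester:
  "set_pmf (conj_tester n k) = {rounds rs True | rs. length rs = k \<and> set rs \<subseteq> cube n}"
  by (auto simp: conj_tester_def set_replicate_pmf)

text \<open>The later masks are independent of the samples of the current round, so commuting the
  draws splits the run into independent rounds. The flag is arbitrary because the induction changes
  it.\<close>

lemma pmf_rounds_True:
  "pmf (bind_pmf (replicate_pmf k (pmf_of_set (cube n))) (\<lambda>rs. run n f (rounds rs b))) True
     = of_bool b * pmf (round_outcome n f) True ^ k"
proof (induction k arbitrary: b)
  case 0
  show ?case by (simp add: bind_return_pmf)
next
  case (Suc k)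
  let ?R = "pmf_of_set (cube n)" and ?S = "pmf_of_set (ones n f)"
  let ?V = "\<lambda>b. bind_pmf (replicate_pmf k ?R) (\<lambda>rs. run n f (rounds rs b))"
  have "bind_pmf (replicate_pmf (Suc k) ?R) (\<lambda>rs. run n f (rounds rs b))
      = bind_pmf ?R (\<lambda>r. bind_pmf (replicate_pmf k ?R) (\<lambda>rs. bind_pmf ?S (\<lambda>w. bind_pmf ?S (\<lambda>x.
          bind_pmf ?S (\<lambda>y. run n f (rounds rs (b \<and> f (vxor y (vand (vxor x w) r)))))))))"
    by (simp add: bind_assoc_pmf bind_return_pmf)
  also have "\<dots> = bind_pmf ?R (\<lambda>r. bind_pmf ?S (\<lambda>w. bind_pmf ?S (\<lambda>x. bind_pmf ?S (\<lambda>y.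
      ?V (b \<and> f (vxor y (vand (vxor x w) r)))))))"
    by (simp add: bind_commute_pmf[of "replicate_pmf k ?R"])
  also have "\<dots> = bind_pmf (round_outcome n f) (\<lambda>c. ?V (b \<and> c))"
    by (simp add: round_outcome_def bind_assoc_pmf bind_return_pmf)
  also have "pmf \<dots> True = (\<Sum>c\<in>UNIV. pmf (round_outcome n f) c * pmf (?V (b \<and> c)) True)"
    unfolding pmf_bind by (subst integral_measure_pmf[of UNIV]) auto
  finally show ?case by (simp add: UNIV_bool Suc.IH)
qed

lemma pmf_verdict_True:
  assumes "ones n f \<noteq> {}"
  shows "pmf (verdict n f (conj_tester n k)) True = (1 - reject_prob n (ones n f)) ^ k"
  using pmf_rounds_True[of k n f True] pmf_True[of "round_outcome n f"]
  by (simp add: verdict_def conj_tester_def bind_map_pmf pmf_round_outcome_False[OF assms])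

lemma reject_prob_le_one: "ones n f \<noteq> {} \<Longrightarrow> reject_prob n (ones n f) \<le> 1"
  by (metis pmf_round_outcome_False pmf_le_1)

section \<open>Oracle calls of the tester\<close>

lemma rounds_calls_indep: "calls f (rounds rs b) s = calls g (rounds rs c) s"
  by (induction rs arbitrary: b c s) auto

lemma length_calls_rounds: "length (calls f (rounds rs b) s) = 4 * length rs"
  by (induction rs arbitrary: b s) auto

lemma rounds_queries:
  assumes "set rs \<subseteq> cube n" and "s \<in> streams (cube n)" and "MQCall z \<in> set (calls f (rounds rs b) s)"
  shows "z \<in> cube n"
  using assms
proof (induction rs arbitrary: b s)
  case (Cons r rs)
  have "s \<in> streams (cube n)" "stl s \<in> streams (cube n)" "stl (stl s) \<in> streams (cube n)"
    and s: "stl (stl (stl s)) \<in> streams (cube n)"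
    using Cons.prems(2) by (simp_all add: streams_stl)
  then have "shd s \<in> cube n" "shd (stl s) \<in> cube n" "shd (stl (stl s)) \<in> cube n"
    by (blast intro: streams_shd)+
  then show ?case using Cons.prems Cons.IH[OF _ s] by auto
qed auto

lemma well_formed_conj_tester: "well_formed n (conj_tester n k)"
  unfolding well_formed_def set_conj_tester
  using rounds_queries streams_mono2[OF ones_cube] by blast

lemma non_adaptive_conj_tester: "non_adaptive n (conj_tester n k)"
  unfolding non_adaptive_def set_conj_tester using rounds_calls_indep by blast

lemma makes_at_most_calls_conj_tester:
  "4 * real k \<le> q \<Longrightarrow> makes_at_most_calls n (conj_tester n k) q"
  by (auto simp: makes_at_most_calls_def set_conj_tester length_calls_rounds)

section \<open>Completeness, soundness and the call bound\<close>

lemma pmf_verdict_conjunction: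
  "f \<in> conjunctions n \<Longrightarrow> ones n f \<noteq> {} \<Longrightarrow> pmf (verdict n f (conj_tester n k)) True = 1"
  by (simp add: pmf_verdict_True reject_prob_conjunction)

lemma pmf_verdict_far:
  assumes ne: "ones n f \<noteq> {}" and "\<epsilon> > 0" and far: "rel_dist_class n f (conjunctions n) \<ge> \<epsilon>"
    and k: "real k \<ge> 200 / \<epsilon>"
  shows "pmf (verdict n f (conj_tester n k)) False \<ge> 2 / 3"
proof -
  let ?p = "reject_prob n (ones n f)"
  \<comment> \<open>If \<open>?p\<close> is below 1/100, the structure result gives the stronger
    bound \<open>2/45 * \<epsilon>\<close>; otherwise \<open>\<epsilon> < 1\<close>
    suffices.\<close>
  have p: "?p \<ge> \<epsilon> / 100"
    using rel_dist_class_le_reject_prob[OF ne] rel_dist_class_less_one[OF ne] far \<open>\<epsilon> > 0\<close>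
    by (cases "?p < 1 / 100") auto
  have "2 \<le> real k * (\<epsilon> / 100)" using k \<open>\<epsilon> > 0\<close> by (simp add: field_simps)
  also have "\<dots> \<le> real k * ?p" using p by (intro mult_left_mono) auto
  finally have kp: "2 \<le> real k * ?p" .
  have "(1 - ?p) ^ k \<le> exp (- ?p) ^ k"
    using exp_ge_add_one_self[of "- ?p"] reject_prob_le_one[OF ne] by (intro power_mono) auto
  also have "\<dots> = exp (- (real k * ?p))" by (simp add: exp_of_nat_mult[symmetric])
  also have "\<dots> \<le> exp (- 2)" using kp by simp
  \<comment> \<open>\<open>exp 2\<close> is at least \<open>1 + 2\<close>.\<close>
  also have "\<dots> \<le> 1 / 3"
    using exp_ge_add_one_self[of "2 :: real"] by (simp add: exp_minus field_simps)
  finally show ?thesis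
    using pmf_True[of "verdict n f (conj_tester n k)"] pmf_verdict_True[OF ne, of k] by linarith
qed

theorem theorem1p1:
  "\<exists>(A :: nat \<Rightarrow> real \<Rightarrow> algorithm) (K :: real). \<forall>n (\<epsilon> :: real). \<epsilon> > 0 \<longrightarrow>
     well_formed n (A n \<epsilon>) \<and>
     rel_error_tester n (conjunctions n) \<epsilon> (A n \<epsilon>) \<and>
     one_sided n (conjunctions n) (A n \<epsilon>) \<and>
     non_adaptive n (A n \<epsilon>) \<and>
     makes_at_most_calls n (A n \<epsilon>) (K / \<epsilon>)"
proof -
  text \<open>For \<open>\<epsilon> > 1\<close> nothing is far, and the bound may leave no room for a single call.\<close>
  define m where "m = (\<lambda>\<epsilon>::real. if \<epsilon> > 1 then 0 else nat \<lceil>200 / \<epsilon>\<rceil>)"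
  have tester: "well_formed n (conj_tester n (m \<epsilon>)) \<and>
     rel_error_tester n (conjunctions n) \<epsilon> (conj_tester n (m \<epsilon>)) \<and>
     one_sided n (conjunctions n) (conj_tester n (m \<epsilon>)) \<and>
     non_adaptive n (conj_tester n (m \<epsilon>)) \<and>
     makes_at_most_calls n (conj_tester n (m \<epsilon>)) (804 / \<epsilon>)" if "\<epsilon> > 0" for n and \<epsilon> :: real
  proof (intro conjI)
    show "rel_error_tester n (conjunctions n) \<epsilon> (conj_tester n (m \<epsilon>))"
      unfolding rel_error_tester_def
    proof (intro ballI impI conjI)
      fix f assume "ones n f \<noteq> {}" and far: "\<epsilon> \<le> rel_dist_class n f (conjunctions n)"
      moreover have "\<epsilon> \<le> 1" using far rel_dist_class_less_one[OF \<open>ones n f \<noteq> {}\<close>] by linarith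
      then have "real (m \<epsilon>) \<ge> 200 / \<epsilon>" by (simp add: m_def real_nat_ceiling_ge)
      ultimately show "pmf (verdict n f (conj_tester n (m \<epsilon>))) False \<ge> 2 / 3"
        using \<open>\<epsilon> > 0\<close> by (intro pmf_verdict_far)
    qed (simp add: pmf_verdict_conjunction)
    \<comment> \<open>A round makes four calls. Rounding up costs at most one extra round, and its
      four calls are at most \<open>4 / \<epsilon>\<close> when \<open>\<epsilon>\<close> is at most
      1.\<close>
    have "4 * real (m \<epsilon>) \<le> 804 / \<epsilon>"
    proof (cases "\<epsilon> > 1")
      case False
      have "0 \<le> 200 / \<epsilon>" using \<open>\<epsilon> > 0\<close> by simp
      then have "real (m \<epsilon>) \<le> 200 / \<epsilon> + 1"
        using False by (simp add: m_def)
      moreover have "1 \<le> 1 / \<epsilon>" using False \<open>\<epsilon> > 0\<close> by simp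
      moreover have "4 * (200 / \<epsilon> + 1) = 800 * (1 / \<epsilon>) + 4" "804 / \<epsilon> = 804 * (1 / \<epsilon>)"
        by simp_all
      ultimately show ?thesis by linarith
    qed (simp add: m_def)
    then show "makes_at_most_calls n (conj_tester n (m \<epsilon>)) (804 / \<epsilon>)"
      by (rule makes_at_most_calls_conj_tester)
    show "one_sided n (conjunctions n) (conj_tester n (m \<epsilon>))"
      by (simp add: one_sided_def pmf_verdict_conjunction)
  qed (rule well_formed_conj_tester non_adaptive_conj_tester)+
  show ?thesis
    by (rule exI[of _ "\<lambda>n \<epsilon>. conj_tester n (m \<epsilon>)"], rule exI[of _ 804])
       (intro allI impI tester)
qed

end
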